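(* For every positive integer $k$, the limit $\lim_{n\to\infty}\frac{\tilde{r}(K_{1,k},C_n)}{n}$ exists (as a finite real number).
   Context: For finite graphs $G$ and $H$, the online Ramsey game is played by Builder and Painter on the infinite complete graph $K_{\mathbb{N}}$ with vertex set $\mathbb{N}$. In each round Builder chooses an edge of $K_{\mathbb{N}}$ and Painter immediately and irrevocably colors it red or blue. (Builder may re-choose an already chosen edge, which keeps its color; this gives Builder no advantage.) The online Ramsey number $\tilde{r}(G,H)$ is the smallest integer $t$ for which Builder has a strategy that guarantees, regardless of Painter's choices, a red copy of $G$ or a blue copy of $H$ (as a not necessarily induced subgraph) within at most $t$ rounds. $C_n$ ($n\ge 3$) denotes the cycle on $n$ vertices and $K_{1,k}$ the star with $k$ edges. *)

theory Defs
  imports Complex_Main "HOL-Library.Ramsey"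
begin

section \<open>Finite graphs\<close>

text \<open>A graph is a pair of a vertex set and a set of two-element edges.\<close>

type_synonym graph = "nat set \<times> nat set set"

definition finite_graph :: "graph \<Rightarrow> bool" where
  "finite_graph G \<longleftrightarrow> finite (fst G) \<and> snd G \<subseteq> [fst G]\<^bsup>2\<^esup>"

definition star :: "nat \<Rightarrow> graph" where
  "star k = ({0..k}, {{0, i} |i. i \<in> {1..k}})"

text \<open>This is the cycle on \<open>n\<close> vertices only for \<open>n \<ge> 3\<close>.\<close>

definition cycle :: "nat \<Rightarrow> graph" where
  "cycle n = ({..<n}, {{i, (i + 1) mod n} |i. i < n})"

lemma finite_graph_star: "finite_graph (star k)"
  by (auto simp: finite_graph_def star_def)

lemma finite_graph_cycle:
  assumes "n \<ge> 3"
  shows "finite_graph (cycle n)"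
proof -
  have "(i + 1) mod n < n \<and> i \<noteq> (i + 1) mod n" if "i < n" for i
    using assms that by (cases "i + 1 = n") auto
  then show ?thesis by (auto simp: finite_graph_def cycle_def)
qed

text \<open>The edge set \<open>F\<close> on the vertices of \<open>K\<^sub>\<nat>\<close> contains a copy of \<open>G\<close>
  as a not necessarily induced subgraph.\<close>

definition contains_copy :: "nat set set \<Rightarrow> graph \<Rightarrow> bool" where
  "contains_copy F G \<longleftrightarrow> (\<exists>f :: nat \<Rightarrow> nat. inj_on f (fst G) \<and> (\<forall>e\<in>snd G. f ` e \<in> F))"


section \<open>The online Ramsey game on the infinite complete graph\<close>

datatype colour = Red | Blue

text \<open>The list of rounds played so far, oldest first: each round records the edge chosen by
  Builder together with its colour.\<close>

type_synonym history = "(nat set \<times> colour) list"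

definition colour_class :: "colour \<Rightarrow> history \<Rightarrow> nat set set" where
  "colour_class c h = {e. (e, c) \<in> set h}"

text \<open>A Builder strategy maps each history to an edge of \<open>K\<^sub>\<nat>\<close>.\<close>

definition builder_strategy :: "(history \<Rightarrow> nat set) \<Rightarrow> bool" where
  "builder_strategy \<sigma> \<longleftrightarrow> (\<forall>h. \<sigma> h \<in> [UNIV]\<^bsup>2\<^esup>)"

text \<open>The histories that can arise when Builder follows \<open>\<sigma>\<close>. Painter's colours are arbitrary,
  except that an edge chosen repeatedly keeps its colour.\<close>

definition play_of :: "(history \<Rightarrow> nat set) \<Rightarrow> history \<Rightarrow> bool" where
  "play_of \<sigma> h \<longleftrightarrow>
     (\<forall>i<length h. fst (h ! i) = \<sigma> (take i h)) \<and>
     (\<forall>i<length h. \<forall>j<length h. fst (h ! i) = fst (h ! j) \<longrightarrow> snd (h ! i) = snd (h ! j))"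

definition builder_goal :: "graph \<Rightarrow> graph \<Rightarrow> history \<Rightarrow> bool" where
  "builder_goal G H h \<longleftrightarrow>
     contains_copy (colour_class Red h) G \<or> contains_copy (colour_class Blue h) H"

definition builder_wins_within :: "graph \<Rightarrow> graph \<Rightarrow> nat \<Rightarrow> bool" where
  "builder_wins_within G H t \<longleftrightarrow>
     (\<exists>\<sigma>. builder_strategy \<sigma> \<and>
          (\<forall>h. play_of \<sigma> h \<and> length h = t \<longrightarrow> (\<exists>s\<le>t. builder_goal G H (take s h))))"

definition online_ramsey :: "graph \<Rightarrow> graph \<Rightarrow> nat" where
  "online_ramsey G H = (LEAST t. builder_wins_within G H t)"

text \<open>By Ramsey's theorem the minimum above is attained for all finite graphs.\<close>

lemma contains_copy_of_clique:
  assumes "finite_graph G" "finite R" "card R = card (fst G)" "[R]\<^bsup>2\<^esup> \<subseteq> F"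
  shows "contains_copy F G"
proof -
  have "finite (fst G)" using assms(1) by (simp add: finite_graph_def)
  then obtain f where f: "bij_betw f (fst G) R"
    using assms(2,3) finite_same_card_bij by metis
  have "f ` e \<in> F" if "e \<in> snd G" for e
  proof -
    have "e \<in> [fst G]\<^bsup>2\<^esup>" using that assms(1) by (auto simp: finite_graph_def)
    then have "f ` e \<in> [R]\<^bsup>2\<^esup>"
      using bij_betw_nsets[OF f, of 2] by (auto simp: bij_betw_def)
    then show ?thesis using assms(4) by blast
  qed
  then show ?thesis using f by (auto simp: contains_copy_def bij_betw_def)
qed

lemma builder_wins_within_exists:
  assumes "finite_graph G" "finite_graph H"
  shows "\<exists>t. builder_wins_within G H t"
proof -
  obtain r where r: "\<And>(V :: nat set) E. finite V \<and> card V \<ge> r \<Longrightarrow>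
      \<exists>R\<subseteq>V. card R = card (fst G) \<and> clique R E \<or> card R = card (fst H) \<and> indep R E"
    using ramsey2[of "card (fst G)" "card (fst H)"] by blast
  obtain es where es: "set es = [{..<r}]\<^bsup>2\<^esup>"
    using finite_list[OF finite_imp_finite_nsets[of "{..<r}" 2]] by auto
  define \<sigma> :: "history \<Rightarrow> nat set" where
    "\<sigma> = (\<lambda>h. if length h < length es then es ! length h else {0, 1})"
  have "\<sigma> h \<in> [UNIV]\<^bsup>2\<^esup>" for h
  proof (cases "length h < length es")
    case True
    then have "es ! length h \<in> [{..<r}]\<^bsup>2\<^esup>" using es nth_mem by blast
    then show ?thesis using True nsets_mono[of "{..<r}" UNIV 2] by (auto simp: \<sigma>_def)
  qed (simp add: \<sigma>_def)
  then have str: "builder_strategy \<sigma>" by (simp add: builder_strategy_def)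
  have "builder_goal G H h" if h: "play_of \<sigma> h" "length h = length es" for h
  proof -
    have hi: "fst (h ! i) = es ! i" if "i < length es" for i
      using h that by (simp add: play_of_def \<sigma>_def)
    have cov: "\<exists>c. (e, c) \<in> set h" if "e \<in> [{..<r}]\<^bsup>2\<^esup>" for e
    proof -
      have "e \<in> set es" using that es by simp
      then obtain i where i: "i < length es" "es ! i = e"
        unfolding in_set_conv_nth by blast
      then have "h ! i = (e, snd (h ! i))" using hi[OF i(1)] by (simp add: prod_eq_iff)
      moreover have "h ! i \<in> set h" using i(1) h(2) by simp
      ultimately show ?thesis by metis
    qed
    obtain R where R: "R \<subseteq> {..<r}" and
      RR: "card R = card (fst G) \<and> clique R (colour_class Red h) \<or>
           card R = card (fst H) \<and> indep R (colour_class Red h)"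
      using r[of "{..<r}" "colour_class Red h"] by auto
    have fin: "finite R" using R finite_subset by blast
    from RR show ?thesis
    proof
      assume *: "card R = card (fst G) \<and> clique R (colour_class Red h)"
      then have "[R]\<^bsup>2\<^esup> \<subseteq> colour_class Red h"
        by (auto simp: clique_def elim!: nsets2_E)
      then show ?thesis
        using contains_copy_of_clique[OF assms(1) fin] * by (simp add: builder_goal_def)
    next
      assume *: "card R = card (fst H) \<and> indep R (colour_class Red h)"
      have "[R]\<^bsup>2\<^esup> \<subseteq> colour_class Blue h"
      proof
        fix e assume e: "e \<in> [R]\<^bsup>2\<^esup>"
        then have "e \<notin> colour_class Red h"
          using * by (auto simp: indep_def elim!: nsets2_E)
        moreover obtain c where "(e, c) \<in> set h"
          using cov e nsets_mono[OF R, of 2] by blast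
        ultimately show "e \<in> colour_class Blue h"
          by (cases c) (auto simp: colour_class_def)
      qed
      then show ?thesis
        using contains_copy_of_clique[OF assms(2) fin] * by (simp add: builder_goal_def)
    qed
  qed
  then have "\<exists>s\<le>length es. builder_goal G H (take s h)"
    if "play_of \<sigma> h" "length h = length es" for h
    using that by (intro exI[of _ "length es"]) simp
  then have "builder_wins_within G H (length es)"
    unfolding builder_wins_within_def using str by blast
  then show ?thesis by blast
qed

end

theory Submission
  imports Defs
begin

text \<open>As long as there is no red \<open>K\<^bsub>1,k\<^esub>\<close>, every vertex has at most \<open>k - 1\<close> red neighbours.
  Hence, if Builder joins two vertices \<open>u\<close> and \<open>v\<close> to the same \<open>2k - 1\<close> untouched vertices, one of
  these vertices is a blue neighbour of both (\<open>common_blue_neighbour\<close>).  This costs a number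
  \<open>C = 2(2k - 1)\<close> of rounds that depends on \<open>k\<close> only, and it adds exactly one vertex, so lengths
  are under full control.

  Let \<open>p(n)\<close> be the online Ramsey number of \<open>K\<^bsub>1,k\<^esub>\<close> against the path on \<open>n\<close> vertices.  After
  forcing a blue path on \<open>n\<close> vertices, Builder can play on an untouched part of the board to force
  a second one on \<open>m\<close> vertices, and then join an end of one to an end of the other, so
  \<open>p(n + m) \<le> p(n + m + 1) \<le> p(n) + p(m) + C\<close> (\<open>forces_longer_path\<close>).  Therefore \<open>p + C\<close> is
  subadditive, and \<open>p(n) / n\<close> converges by Fekete's lemma.

  Joining the two ends of a single path closes it to a cycle with one more vertex
  (\<open>forces_cycle\<close>), while a cycle contains a path on the same vertices.  So the number for \<open>C\<^sub>n\<close>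
  lies between \<open>p(n)\<close> and \<open>p(n - 1) + C \<le> p(n) + C\<close>, and has the same limit after division by \<open>n\<close>.

  Combining strategies is awkward when they are functions of the whole history.  The game is
  therefore first restated as a recursion on positions, in which running one strategy after
  another is an induction (\<open>forces_trans\<close>).\<close>

section \<open>Fekete's lemma\<close>

lemma subadditive_mult_add:
  fixes a :: "nat \<Rightarrow> real"
  assumes "\<And>m n. a (m + n) \<le> a m + a n"
  shows "a (q * m + r) \<le> real q * a m + a r"
proof (induction q)
  case (Suc q)
  have "a (Suc q * m + r) \<le> a m + a (q * m + r)"
    using assms[of m "q * m + r"] by (simp add: algebra_simps)
  then show ?case using Suc by (simp add: algebra_simps)
qed simp

text \<open>The limit is the infimum of \<open>a n / n\<close>: if \<open>m\<close> almost attains it, then dividing \<open>n\<close> by \<open>m\<close>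
  with remainder bounds \<open>a n\<close> by \<open>(n / m) * a m\<close> up to a constant depending on \<open>m\<close> only.\<close>

lemma fekete_nonneg:
  fixes a :: "nat \<Rightarrow> real"
  assumes subadd: "\<And>m n. a (m + n) \<le> a m + a n" and nonneg: "\<And>n. 0 \<le> a n"
  shows "\<exists>L. (\<lambda>n. a n / real n) \<longlonglongrightarrow> L"
proof -
  define L where "L = (INF n\<in>{1..}. a n / real n)"
  have bdd: "bdd_below ((\<lambda>n. a n / real n) ` {1..})"
    using nonneg by (intro bdd_belowI[of _ 0]) auto
  have lower: "L \<le> a n / real n" if "n \<ge> 1" for n
    unfolding L_def using bdd that by (intro cINF_lower) auto
  have "(\<lambda>n. a n / real n) \<longlonglongrightarrow> L"
  proof (rule LIMSEQ_I)
    fix e :: real assume e: "0 < e"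
    have "\<exists>m\<in>{1..}. a m / real m < L + e / 2"
    proof (rule ccontr)
      assume "\<not> ?thesis"
      then have "L + e / 2 \<le> (INF n\<in>{1..}. a n / real n)"
        by (intro cINF_greatest) (auto simp: not_less)
      then show False using e by (simp add: L_def)
    qed
    then obtain m where m: "m \<ge> 1" "a m / real m < L + e / 2" by auto
    define M where "M = (\<Sum>r<m. a r)"
    have M: "a r \<le> M" if "r < m" for r
      unfolding M_def using that nonneg by (intro member_le_sum) auto
    have upper: "a n / real n \<le> a m / real m + M / real n" if "n \<ge> 1" for n
    proof -
      have "a n = a (n div m * m + n mod m)" by simp
      also have "\<dots> \<le> real (n div m) * a m + a (n mod m)"
        by (rule subadditive_mult_add[OF subadd])
      also have "\<dots> \<le> real n / real m * a m + M"
        using M[of "n mod m"] m(1) nonneg[of m]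
        by (intro add_mono mult_right_mono of_nat_div_le_of_nat) auto
      finally have "a n / real n \<le> (real n / real m * a m + M) / real n"
        by (rule divide_right_mono) simp
      also have "\<dots> = a m / real m + M / real n"
        using that m(1) by (simp add: field_simps)
      finally show ?thesis .
    qed
    have "(\<lambda>n. M / real n) \<longlonglongrightarrow> 0" by (rule lim_const_over_n)
    then obtain n0 where n0: "\<And>n. n \<ge> n0 \<Longrightarrow> norm (M / real n - 0) < e / 2"
      using LIMSEQ_D[of _ 0 "e / 2"] e by (metis half_gt_zero)
    have "norm (a n / real n - L) < e" if "n \<ge> max 1 n0" for n
    proof -
      have "M / real n \<le> norm (M / real n - 0)"
        unfolding diff_0_right real_norm_def by (rule abs_ge_self)
      with upper[of n] lower[of n] n0[of n] m(2) that
      have "L \<le> a n / real n" "a n / real n < L + e" by linarith+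
      then show ?thesis by simp
    qed
    then show "\<exists>no. \<forall>n\<ge>no. norm (a n / real n - L) < e" by blast
  qed
  then show ?thesis by blast
qed


section \<open>The game on positions\<close>

text \<open>A position is the pair of the red and the blue edge sets.  The two implications let Builder
  choose a coloured edge again, which leaves the position unchanged, so that the recursion follows
  the rules of the game exactly.\<close>

fun forces :: "(nat set set \<Rightarrow> nat set set \<Rightarrow> bool) \<Rightarrow> nat \<Rightarrow> nat set set \<Rightarrow> nat set set \<Rightarrow> bool" where
  "forces Q 0 R B = Q R B"
| "forces Q (Suc t) R B = (\<exists>e\<in>[UNIV]\<^bsup>2\<^esup>.
     (e \<notin> B \<longrightarrow> forces Q t (insert e R) B) \<and> (e \<notin> R \<longrightarrow> forces Q t R (insert e B)))"

definition won :: "graph \<Rightarrow> graph \<Rightarrow> nat set set \<Rightarrow> nat set set \<Rightarrow> bool" where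
  "won G H R B \<longleftrightarrow> contains_copy R G \<or> contains_copy B H"

lemma contains_copy_mono: "contains_copy F G \<Longrightarrow> F \<subseteq> F' \<Longrightarrow> contains_copy F' G"
  unfolding contains_copy_def by blast

lemma won_mono: "won G H R B \<Longrightarrow> R \<subseteq> R' \<Longrightarrow> B \<subseteq> B' \<Longrightarrow> won G H R' B'"
  unfolding won_def using contains_copy_mono by blast

lemma colour_class_snoc:
  "colour_class c (h @ [(e, d)]) = (if c = d then insert e (colour_class c h) else colour_class c h)"
  by (auto simp: colour_class_def)

lemma play_of_snoc_iff:
  "play_of \<sigma> (h @ [(e, c)]) \<longleftrightarrow>
     play_of \<sigma> h \<and> e = \<sigma> h \<and> (\<forall>d. (e, d) \<in> set h \<longrightarrow> d = c)"
proof -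
  let ?same = "\<lambda>x y. fst x = fst y \<longrightarrow> snd x = snd y"
  have pairs: "(\<forall>i<length l. \<forall>j<length l. ?same (l ! i) (l ! j)) \<longleftrightarrow>
      (\<forall>x\<in>set l. \<forall>y\<in>set l. ?same x y)" for l :: history
    by (simp add: all_set_conv_all_nth)
  have moves: "(\<forall>i<length (h @ [x]). fst ((h @ [x]) ! i) = \<sigma> (take i (h @ [x]))) \<longleftrightarrow>
      (\<forall>i<length h. fst (h ! i) = \<sigma> (take i h)) \<and> fst x = \<sigma> h" for x
    by (auto simp: nth_append less_Suc_eq)
  have new: "(\<forall>x\<in>set (h @ [(e, c)]). \<forall>y\<in>set (h @ [(e, c)]). ?same x y) \<longleftrightarrow>
      (\<forall>x\<in>set h. \<forall>y\<in>set h. ?same x y) \<and> (\<forall>d. (e, d) \<in> set h \<longrightarrow> d = c)"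
  proof -
    have "(\<forall>d. (e, d) \<in> set h \<longrightarrow> d = c) \<longleftrightarrow> (\<forall>y\<in>set h. fst y = e \<longrightarrow> snd y = c)" by auto
    then show ?thesis by (simp add: ball_Un eq_commute[of e] eq_commute[of c] conj_ac) blast
  qed
  show ?thesis
    unfolding play_of_def pairs moves new by auto
qed

text \<open>A goal reached
  before the last round is still present at the end, because a contained copy stays contained when
  edges are added; this is why \<open>forces\<close> only looks at the final position.\<close>

lemma forces_of_builder_wins:
  assumes "builder_wins_within G H t"
  shows "forces (won G H) t {} {}"
proof -
  obtain \<sigma> where \<sigma>: "builder_strategy \<sigma>" and
    win: "\<And>h. play_of \<sigma> h \<Longrightarrow> length h = t \<Longrightarrow> \<exists>s\<le>t. builder_goal G H (take s h)"
    using assms unfolding builder_wins_within_def by blast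
  have "forces (won G H) j (colour_class Red h) (colour_class Blue h)"
    if "play_of \<sigma> h" "length h + j = t" for h j
    using that
  proof (induction j arbitrary: h)
    case 0
    then obtain s where "builder_goal G H (take s h)" using win by auto
    then have "won G H (colour_class Red (take s h)) (colour_class Blue (take s h))"
      by (simp add: won_def builder_goal_def)
    moreover have "colour_class c (take s h) \<subseteq> colour_class c h" for c
      using set_take_subset[of s h] by (auto simp: colour_class_def)
    ultimately show ?case using won_mono by auto
  next
    case (Suc j)
    have legal: "play_of \<sigma> (h @ [(\<sigma> h, c)])" if "\<And>d. d \<noteq> c \<Longrightarrow> \<sigma> h \<notin> colour_class d h" for c
      using Suc.prems that by (auto simp: play_of_snoc_iff colour_class_def)
    have "forces (won G H) j (insert (\<sigma> h) (colour_class Red h)) (colour_class Blue h)"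
      if "\<sigma> h \<notin> colour_class Blue h"
    proof -
      have "play_of \<sigma> (h @ [(\<sigma> h, Red)])" by (rule legal) (use that colour.exhaust in metis)
      from Suc.IH[OF this] show ?thesis using Suc.prems by (simp add: colour_class_snoc)
    qed
    moreover have "forces (won G H) j (colour_class Red h) (insert (\<sigma> h) (colour_class Blue h))"
      if "\<sigma> h \<notin> colour_class Red h"
    proof -
      have "play_of \<sigma> (h @ [(\<sigma> h, Blue)])" by (rule legal) (use that colour.exhaust in metis)
      from Suc.IH[OF this] show ?thesis using Suc.prems by (simp add: colour_class_snoc)
    qed
    moreover have "\<sigma> h \<in> [UNIV]\<^bsup>2\<^esup>" using \<sigma> by (simp add: builder_strategy_def)
    ultimately show ?case by auto
  qed
  from this[of "[]" t] show ?thesis by (simp add: play_of_def colour_class_def)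
qed

text \<open>The strategy picks, after each history, an edge that witnesses the existential quantifier in
  \<open>forces\<close> for the number of rounds that are left.\<close>

lemma builder_wins_of_forces:
  assumes "forces (won G H) t {} {}"
  shows "builder_wins_within G H t"
proof -
  define good where "good j e R B \<longleftrightarrow> e \<in> [UNIV]\<^bsup>2\<^esup> \<and>
     (e \<notin> B \<longrightarrow> forces (won G H) j (insert e R) B) \<and>
     (e \<notin> R \<longrightarrow> forces (won G H) j R (insert e B))" for j e R B
  \<comment> \<open>The edge \<open>{0, 1}\<close> is a default for histories from which nothing can be forced.\<close>
  define \<sigma> :: "history \<Rightarrow> nat set" where
    "\<sigma> h = (let j = t - Suc (length h); R = colour_class Red h; B = colour_class Blue h in
       if \<exists>e. good j e R B then SOME e. good j e R B else {0, 1})" for h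
  have \<sigma>_good: "good j (\<sigma> h) (colour_class Red h) (colour_class Blue h)"
    if "forces (won G H) (Suc j) (colour_class Red h) (colour_class Blue h)"
       "j = t - Suc (length h)" for h j
  proof -
    have "\<exists>e. good j e (colour_class Red h) (colour_class Blue h)"
      using that(1) by (auto simp: good_def)
    then show ?thesis unfolding \<sigma>_def Let_def that(2)[symmetric] by (auto intro: someI_ex)
  qed
  have "\<sigma> h \<in> [UNIV]\<^bsup>2\<^esup>" for h
  proof (cases "\<exists>e. good (t - Suc (length h)) e (colour_class Red h) (colour_class Blue h)")
    case True
    from someI_ex[OF this] show ?thesis using True by (auto simp: \<sigma>_def Let_def good_def)
  qed (simp add: \<sigma>_def)
  then have "builder_strategy \<sigma>" by (simp add: builder_strategy_def)
  moreover have "forces (won G H) (t - length h) (colour_class Red h) (colour_class Blue h)"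
    if "play_of \<sigma> h" "length h \<le> t" for h
    using that
  proof (induction h rule: rev_induct)
    case Nil
    then show ?case using assms by (simp add: colour_class_def)
  next
    case (snoc x h)
    obtain e c where x: "x = (e, c)" by (cases x)
    have play: "play_of \<sigma> h" "e = \<sigma> h" and col: "\<And>d. (e, d) \<in> set h \<Longrightarrow> d = c"
      using snoc.prems unfolding x play_of_snoc_iff by auto
    define j where "j = t - Suc (length h)"
    have j: "t - length h = Suc j" using snoc.prems by (simp add: j_def)
    have "good j e (colour_class Red h) (colour_class Blue h)"
      unfolding play(2) using snoc.IH play(1) snoc.prems by (intro \<sigma>_good) (auto simp: j j_def)
    moreover have "c = Red \<Longrightarrow> e \<notin> colour_class Blue h" "c = Blue \<Longrightarrow> e \<notin> colour_class Red h"
      using col by (auto simp: colour_class_def)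
    ultimately show ?case
      by (cases c) (auto simp: x colour_class_snoc good_def j_def)
  qed
  then have "builder_goal G H (take t h)" if "play_of \<sigma> h" "length h = t" for h
    using that by (fastforce simp: won_def builder_goal_def)
  ultimately show ?thesis unfolding builder_wins_within_def by blast
qed

lemma online_ramsey_le:
  assumes "forces (won G H) t {} {}"
  shows "online_ramsey G H \<le> t"
  unfolding online_ramsey_def using builder_wins_of_forces[OF assms] by (rule Least_le)

lemma forces_online_ramsey:
  assumes "finite_graph G" "finite_graph H"
  shows "forces (won G H) (online_ramsey G H) {} {}"
  using builder_wins_within_exists[OF assms] forces_of_builder_wins LeastI_ex
  unfolding online_ramsey_def by metis


section \<open>Combining strategies\<close>

lemma forces_weaken:
  assumes "forces Q t R B" "\<And>R B. Q R B \<Longrightarrow> Q' R B"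
  shows "forces Q' t R B"
  using assms(1)
proof (induction t arbitrary: R B)
  case (Suc t)
  then show ?case by (metis forces.simps(2))
qed (use assms(2) in simp)

text \<open>If Builder is ahead of schedule, the remaining rounds can be spent on any edge.\<close>

lemma forces_idle:
  assumes "Q R B" "\<And>R B R' B'. Q R B \<Longrightarrow> R \<subseteq> R' \<Longrightarrow> B \<subseteq> B' \<Longrightarrow> Q R' B'"
  shows "forces Q t R B"
  using assms(1)
proof (induction t arbitrary: R B)
  case (Suc t)
  have "{0, 1 :: nat} \<in> [UNIV]\<^bsup>2\<^esup>" by simp
  moreover have "Q (insert e R) B" "Q R (insert e B)" for e
    using Suc.prems assms(2) by blast+
  ultimately show ?case using Suc.IH by (metis forces.simps(2))
qed simp

lemma forces_edges:
  assumes "set es \<subseteq> [UNIV]\<^bsup>2\<^esup>"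
  shows "forces (\<lambda>R' B'. R \<subseteq> R' \<and> B \<subseteq> B' \<and> set es \<subseteq> R' \<union> B') (length es) R B"
  using assms
proof (induction es arbitrary: R B)
  case (Cons e es)
  have "forces (\<lambda>R' B'. R \<subseteq> R' \<and> B \<subseteq> B' \<and> set (e # es) \<subseteq> R' \<union> B') (length es) (insert e R) B"
    using Cons by (intro forces_weaken[OF Cons.IH]) auto
  moreover have
    "forces (\<lambda>R' B'. R \<subseteq> R' \<and> B \<subseteq> B' \<and> set (e # es) \<subseteq> R' \<union> B') (length es) R (insert e B)"
    using Cons by (intro forces_weaken[OF Cons.IH]) auto
  ultimately show ?case using Cons.prems by auto
qed simp

text \<open>The invariant of real play.  Finiteness guarantees untouched vertices; that edges are
  nonempty is what makes a part of the board without touched vertices look empty.\<close>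

definition position :: "nat set set \<Rightarrow> nat set set \<Rightarrow> bool" where
  "position R B \<longleftrightarrow> finite (R \<union> B) \<and> R \<union> B \<subseteq> [UNIV]\<^bsup>2\<^esup>"

lemma forces_trans:
  assumes "forces Q s R B" "position R B"
    and "\<And>R' B'. R \<subseteq> R' \<Longrightarrow> B \<subseteq> B' \<Longrightarrow> position R' B' \<Longrightarrow> Q R' B' \<Longrightarrow> forces Q' t R' B'"
  shows "forces Q' (s + t) R B"
  using assms
proof (induction s arbitrary: R B)
  case (Suc s)
  from Suc.prems(1) obtain e where e: "e \<in> [UNIV]\<^bsup>2\<^esup>"
    "e \<notin> B \<Longrightarrow> forces Q s (insert e R) B" "e \<notin> R \<Longrightarrow> forces Q s R (insert e B)" by auto
  have pos: "position (insert e R) B" "position R (insert e B)"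
    using Suc.prems(2) e(1) by (auto simp: position_def)
  have "forces Q' (s + t) (insert e R) B" if "e \<notin> B"
    by (rule Suc.IH[OF e(2)[OF that] pos(1)]) (use Suc.prems(3) in auto)
  moreover have "forces Q' (s + t) R (insert e B)" if "e \<notin> R"
    by (rule Suc.IH[OF e(3)[OF that] pos(2)]) (use Suc.prems(3) in auto)
  ultimately show ?case using e(1) by auto
qed simp

text \<open>Builder can run a strategy on the copy of the board that an injection \<open>\<phi>\<close> carves out of it:
  what happens elsewhere does not influence the position seen through \<open>\<phi>\<close>.  Taking preimages rather
  than images of the edge sets makes this hold with equality after every round.\<close>

lemma forces_relabel:
  assumes "inj \<phi>" "forces Q t {e. \<phi> ` e \<in> R} {e. \<phi> ` e \<in> B}"
  shows "forces (\<lambda>R B. Q {e. \<phi> ` e \<in> R} {e. \<phi> ` e \<in> B}) t R B"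
  using assms(2)
proof (induction t arbitrary: R B)
  case (Suc t)
  from Suc.prems obtain e where e: "e \<in> [UNIV]\<^bsup>2\<^esup>"
    "\<phi> ` e \<notin> B \<Longrightarrow> forces Q t (insert e {e. \<phi> ` e \<in> R}) {e. \<phi> ` e \<in> B}"
    "\<phi> ` e \<notin> R \<Longrightarrow> forces Q t {e. \<phi> ` e \<in> R} (insert e {e. \<phi> ` e \<in> B})" by auto
  have ins: "insert e {e. \<phi> ` e \<in> F} = {e'. \<phi> ` e' \<in> insert (\<phi> ` e) F}" for F
    using inj_image_eq_iff[OF assms(1)] by auto
  have "\<phi> ` e \<in> [UNIV]\<^bsup>2\<^esup>"
    using e(1) assms(1) by (auto simp: nsets_def card_image inj_on_subset)
  moreover note e(2,3)[unfolded ins, THEN Suc.IH]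
  ultimately show ?case by auto
qed simp


section \<open>Joining blue paths through a fresh vertex\<close>

definition path :: "nat \<Rightarrow> graph" where
  "path n = ({..<n}, {{i, Suc i} |i. Suc i < n})"

lemma finite_graph_path: "finite_graph (path n)"
  by (auto simp: finite_graph_def path_def)

lemma contains_path_iff:
  "contains_copy F (path n) \<longleftrightarrow>
     (\<exists>f. inj_on f {..<n} \<and> (\<forall>i. Suc i < n \<longrightarrow> {f i, f (Suc i)} \<in> F))"
proof -
  have "snd (path n) = (\<lambda>i. {i, Suc i}) ` {i. Suc i < n}" by (auto simp: path_def)
  then have "(\<forall>e\<in>snd (path n). f ` e \<in> F) \<longleftrightarrow> (\<forall>i. Suc i < n \<longrightarrow> {f i, f (Suc i)} \<in> F)" for f
    by simp
  then show ?thesis by (simp add: contains_copy_def path_def)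
qed

lemma contains_shorter_path:
  assumes "contains_copy F (path n)" "m \<le> n"
  shows "contains_copy F (path m)"
proof -
  obtain f where f: "inj_on f {..<n}" "\<And>i. Suc i < n \<Longrightarrow> {f i, f (Suc i)} \<in> F"
    using assms(1) by (auto simp: contains_path_iff)
  have "inj_on f {..<m}" using f(1) by (rule inj_on_subset) (use assms(2) in auto)
  then show ?thesis using f(2) assms(2) by (auto simp: contains_path_iff)
qed

lemma contains_path_of_cycle:
  assumes "contains_copy F (cycle n)"
  shows "contains_copy F (path n)"
proof -
  obtain f where f: "inj_on f {..<n}" "\<And>e. e \<in> snd (cycle n) \<Longrightarrow> f ` e \<in> F"
    using assms by (auto simp: contains_copy_def cycle_def)
  have "{f i, f (Suc i)} \<in> F" if "Suc i < n" for i
  proof -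
    have "{i, Suc i} \<in> snd (cycle n)" using that by (force simp: cycle_def)
    from f(2)[OF this] show ?thesis by simp
  qed
  then show ?thesis using f(1) by (auto simp: contains_path_iff)
qed

lemma contains_joined_path:
  assumes f: "inj_on f {..<n}" "\<And>i. Suc i < n \<Longrightarrow> {f i, f (Suc i)} \<in> F"
    and g: "inj_on g {..<m}" "\<And>i. Suc i < m \<Longrightarrow> {g i, g (Suc i)} \<in> F"
    and disjoint: "f ` {..<n} \<inter> g ` {..<m} = {}"
    and w: "w \<notin> f ` {..<n} \<union> g ` {..<m}" "{f (n - 1), w} \<in> F" "{g 0, w} \<in> F"
  shows "contains_copy F (path (n + m + 1))"
proof -
  define h where "h i = (if i < n then f i else if i = n then w else g (i - n - 1))" for i
  have "inj_on h {..<n + m + 1}"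
  proof (rule inj_onI)
    fix i j assume ij: "i \<in> {..<n + m + 1}" "j \<in> {..<n + m + 1}" "h i = h j"
    have sub: "x - Suc n < m" if "n < x" "x < Suc (n + m)" for x using that by linarith
    have fg: "f a \<noteq> g b" if "a < n" "b < m" for a b using disjoint that by blast
    have fw: "f a \<noteq> w" if "a < n" for a using w(1) that by blast
    have gw: "g b \<noteq> w" if "b < m" for b using w(1) that by blast
    have gg: "a = b" if "g a = g b" "a < m" "b < m" for a b
      using inj_onD[OF g(1) that(1)] that by auto
    have ff: "a = b" if "f a = f b" "a < n" "b < n" for a b
      using inj_onD[OF f(1) that(1)] that by auto
    consider "i < n" | "i = n" | "i > n" by linarith
    then show "i = j"
    proof cases
      case 1
      then show ?thesis using ij sub[of j] ff[of i j] fw[of i] fg[of i "j - n - 1"]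
        by (auto simp: h_def split: if_splits)
    next
      case 2
      then show ?thesis using ij sub[of j] fw[of j] gw[of "j - n - 1"]
        by (auto simp: h_def split: if_splits)
    next
      case 3
      then show ?thesis
        using ij sub[of i] sub[of j] gg[of "i - n - 1" "j - n - 1"] gw[of "i - n - 1"] fg[of j "i - n - 1"]
        by (auto simp: h_def split: if_splits)
    qed
  qed
  moreover have "{h i, h (Suc i)} \<in> F" if "Suc i < n + m + 1" for i
  proof -
    consider "Suc i < n" | "Suc i = n" | "i = n" | "i > n" by linarith
    then show ?thesis
    proof cases
      case 2
      then have "i = n - 1" by simp
      then show ?thesis using 2 w(2) by (simp add: h_def)
    next
      case 4
      then have "Suc i - n - 1 = Suc (i - n - 1)" by simp
      then show ?thesis using 4 g(2)[of "i - n - 1"] that by (simp add: h_def)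
    qed (use f(2) w(3) in \<open>auto simp: h_def insert_commute\<close>)
  qed
  ultimately show ?thesis by (auto simp: contains_path_iff)
qed

lemma contains_closed_path:
  assumes f: "inj_on f {..<n}" "\<And>i. Suc i < n \<Longrightarrow> {f i, f (Suc i)} \<in> F"
    and w: "w \<notin> f ` {..<n}" "{f (n - 1), w} \<in> F" "{f 0, w} \<in> F"
    and "n \<ge> 1"
  shows "contains_copy F (cycle (Suc n))"
proof -
  define h where "h = f(n := w)"
  have "inj_on h {..<Suc n}"
    using f(1) w(1) by (auto simp: h_def lessThan_Suc inj_on_def)
  moreover have "{h i, h (Suc i mod Suc n)} \<in> F" if i: "i < Suc n" for i
  proof -
    consider "Suc i < n" | "Suc i = n" | "i = n" using i by linarith
    then show ?thesis
    proof cases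
      case 2
      then have "i = n - 1" by simp
      then show ?thesis using 2 w(2) by (simp add: h_def)
    qed (use f(2) w(3) \<open>n \<ge> 1\<close> in \<open>auto simp: h_def insert_commute\<close>)
  qed
  ultimately show ?thesis unfolding contains_copy_def cycle_def by auto
qed

lemma contains_star:
  assumes "k \<le> card W" "finite W" "u \<notin> W" "\<And>w. w \<in> W \<Longrightarrow> {u, w} \<in> F"
  shows "contains_copy F (star k)"
proof -
  obtain g where g: "inj_on g {1..k}" "g ` {1..k} \<subseteq> W"
    using card_le_inj[of "{1..k}" W] assms(1,2) by auto
  define f where "f = g(0 := u)"
  have gW: "g i \<in> W" if "i \<in> {1..k}" for i using g(2) that by blast
  have "{0..k} = insert 0 {1..k}" by auto
  moreover have "inj_on f {1..k}"
    using g(1) inj_on_cong[of "{1..k}" f g] by (simp add: f_def)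
  moreover have "f 0 \<notin> f ` {1..k}" using gW assms(3) by (auto simp: f_def)
  ultimately have "inj_on f {0..k}" by simp
  moreover have "f ` e \<in> F" if "e \<in> snd (star k)" for e
    using that gW assms(4) by (auto simp: star_def f_def insert_commute[of _ u])
  ultimately show ?thesis unfolding contains_copy_def by (auto simp: star_def)
qed

text \<open>Each of \<open>u\<close> and \<open>v\<close> is joined in red to at most \<open>k - 1\<close> of the \<open>2k - 1\<close> vertices, which leaves
  at least one.\<close>

lemma common_blue_neighbour:
  assumes "finite W" "card W = 2 * k - 1" "k \<ge> 1" "u \<notin> W" "v \<notin> W"
    and coloured: "\<And>w. w \<in> W \<Longrightarrow> {u, w} \<in> R \<union> B" "\<And>w. w \<in> W \<Longrightarrow> {v, w} \<in> R \<union> B"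
    and no_star: "\<not> contains_copy R (star k)"
  shows "\<exists>w\<in>W. {u, w} \<in> B \<and> {v, w} \<in> B"
proof (rule ccontr)
  assume none: "\<not> ?thesis"
  define red where "red x = {w \<in> W. {x, w} \<in> R}" for x
  have few: "card (red x) < k" if "x \<notin> W" for x
  proof (rule ccontr)
    assume "\<not> card (red x) < k"
    then have "contains_copy R (star k)"
      using that assms(1) by (intro contains_star[of k "red x" x]) (auto simp: red_def)
    then show False using no_star by simp
  qed
  have "W \<subseteq> red u \<union> red v" using none coloured by (auto simp: red_def)
  then have "card W \<le> card (red u \<union> red v)"
    using assms(1) by (intro card_mono) (auto simp: red_def)
  also have "\<dots> \<le> card (red u) + card (red v)" by (rule card_Un_le)
  finally show False using few[OF assms(4)] few[OF assms(5)] assms(2) by linarith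
qed

lemma forces_star:
  assumes "contains_copy R (star k)"
  shows "forces (won (star k) H) t R B"
proof (rule forces_idle)
  show "won (star k) H R B" using assms by (simp add: won_def)
qed (rule won_mono)

definition joining_cost :: "nat \<Rightarrow> nat" where
  "joining_cost k = 2 * (2 * k - 1)"

text \<open>The set \<open>X\<close> holds the vertices of the paths to be joined: the connecting vertex must not lie
  on them.\<close>

lemma forces_common_blue_neighbour:
  assumes "k \<ge> 1" "finite X" "u \<in> X" "v \<in> X"
  shows "forces (\<lambda>R' B'. B \<subseteq> B' \<and>
           (contains_copy R' (star k) \<or> (\<exists>w. w \<notin> X \<and> {u, w} \<in> B' \<and> {v, w} \<in> B')))
         (joining_cost k) R B"
proof -
  obtain N where N: "\<And>x. x \<in> X \<Longrightarrow> x < N"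
    using assms(2) finite_nat_set_iff_bounded by metis
  define ws where "ws = [N..<N + (2 * k - 1)]"
  define es where "es = map (\<lambda>w. {u, w}) ws @ map (\<lambda>w. {v, w}) ws"
  have fresh: "x \<notin> set ws" if "x \<in> X" for x using N[OF that] by (simp add: ws_def)
  have "set es \<subseteq> [UNIV]\<^bsup>2\<^esup>"
    using fresh[OF assms(3)] fresh[OF assms(4)] by (auto simp: es_def)
  then have "forces (\<lambda>R' B'. R \<subseteq> R' \<and> B \<subseteq> B' \<and> set es \<subseteq> R' \<union> B') (length es) R B"
    by (rule forces_edges)
  moreover have "length es = joining_cost k"
    by (simp add: es_def ws_def joining_cost_def)
  ultimately have drawn:
    "forces (\<lambda>R' B'. R \<subseteq> R' \<and> B \<subseteq> B' \<and> set es \<subseteq> R' \<union> B') (joining_cost k) R B" by simp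
  show ?thesis
  proof (rule forces_weaken[OF drawn], intro conjI)
    fix R' B' assume *: "R \<subseteq> R' \<and> B \<subseteq> B' \<and> set es \<subseteq> R' \<union> B'"
    then show "B \<subseteq> B'" by simp
    have "\<exists>w\<in>set ws. {u, w} \<in> B' \<and> {v, w} \<in> B'" if "\<not> contains_copy R' (star k)"
    proof (rule common_blue_neighbour)
      show "card (set ws) = 2 * k - 1" by (simp add: ws_def)
      show "{u, w} \<in> R' \<union> B'" if "w \<in> set ws" for w
        using * that by (auto simp: es_def image_subset_iff)
      show "{v, w} \<in> R' \<union> B'" if "w \<in> set ws" for w
        using * that by (auto simp: es_def image_subset_iff)
    qed (use that fresh assms in auto)
    then show "contains_copy R' (star k) \<or> (\<exists>w. w \<notin> X \<and> {u, w} \<in> B' \<and> {v, w} \<in> B')"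
      using fresh by blast
  qed
qed

lemma forces_cycle:
  assumes "k \<ge> 1" "n \<ge> 1" "forces (won (star k) (path n)) s {} {}"
  shows "forces (won (star k) (cycle (Suc n))) (s + joining_cost k) {} {}"
proof (rule forces_trans[OF assms(3)])
  show "position {} {}" by (simp add: position_def)
next
  fix R B assume "won (star k) (path n) R B"
  then consider "contains_copy R (star k)" | "contains_copy B (path n)" by (auto simp: won_def)
  then show "forces (won (star k) (cycle (Suc n))) (joining_cost k) R B"
  proof cases
    case 1
    then show ?thesis by (rule forces_star)
  next
    case 2
    then obtain f where f: "inj_on f {..<n}" "\<And>i. Suc i < n \<Longrightarrow> {f i, f (Suc i)} \<in> B"
      by (auto simp: contains_path_iff)
    show ?thesis
    proof (rule forces_weaken[OF forces_common_blue_neighbour])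
      fix R' B' assume *: "B \<subseteq> B' \<and> (contains_copy R' (star k) \<or>
        (\<exists>w. w \<notin> f ` {..<n} \<and> {f (n - 1), w} \<in> B' \<and> {f 0, w} \<in> B'))"
      then show "won (star k) (cycle (Suc n)) R' B'"
        using contains_closed_path[OF f(1), of B'] f(2) assms(2) unfolding won_def by blast
    qed (use assms in auto)
  qed
qed

lemma forces_longer_path:
  assumes "k \<ge> 1" "n \<ge> 1" "m \<ge> 1"
    and "forces (won (star k) (path n)) s {} {}" "forces (won (star k) (path m)) t {} {}"
  shows "forces (won (star k) (path (n + m + 1))) (s + (t + joining_cost k)) {} {}"
proof (rule forces_trans[OF assms(4)])
  show "position {} {}" by (simp add: position_def)
next
  let ?Q = "won (star k) (path (n + m + 1))"
  fix R B assume pos: "position R B" and "won (star k) (path n) R B"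
  then consider "contains_copy R (star k)" | "contains_copy B (path n)" by (auto simp: won_def)
  then show "forces ?Q (t + joining_cost k) R B"
  proof cases
    case 1
    then show ?thesis by (rule forces_star)
  next
    case 2
    then obtain f where f: "inj_on f {..<n}" "\<And>i. Suc i < n \<Longrightarrow> {f i, f (Suc i)} \<in> B"
      by (auto simp: contains_path_iff)
    have "finite (\<Union> (R \<union> B) \<union> f ` {..<n})"
      using pos by (auto simp: position_def nsets_def)
    then obtain N where N: "\<And>x. x \<in> \<Union> (R \<union> B) \<union> f ` {..<n} \<Longrightarrow> x < N"
      using finite_nat_set_iff_bounded by metis
    \<comment> \<open>The second path is forced beyond all vertices touched so far, where the board is empty.\<close>
    define \<phi> where "\<phi> = (\<lambda>x. x + N)"
    have \<phi>: "inj \<phi>" by (simp add: \<phi>_def inj_def)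
    have "\<phi> ` e \<notin> R \<union> B" for e
    proof
      assume e: "\<phi> ` e \<in> R \<union> B"
      then have "\<phi> ` e \<noteq> {}" using pos by (force simp: position_def nsets_def)
      then obtain x where "x \<in> e" by auto
      then have "\<phi> x \<in> \<Union> (R \<union> B)" using e by blast
      then have "\<phi> x < N" using N by blast
      then show False by (simp add: \<phi>_def)
    qed
    then have "{e. \<phi> ` e \<in> R} = {}" "{e. \<phi> ` e \<in> B} = {}" by auto
    then have "forces (\<lambda>R B. won (star k) (path m) {e. \<phi> ` e \<in> R} {e. \<phi> ` e \<in> B}) t R B"
      using assms(5) by (intro forces_relabel[OF \<phi>]) simp
    then show ?thesis
    proof (rule forces_trans[OF _ pos])
      fix R1 B1 assume ext: "B \<subseteq> B1"
        and "won (star k) (path m) {e. \<phi> ` e \<in> R1} {e. \<phi> ` e \<in> B1}"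
      then consider "contains_copy {e. \<phi> ` e \<in> R1} (star k)"
        | "contains_copy {e. \<phi> ` e \<in> B1} (path m)" by (auto simp: won_def)
      then show "forces ?Q (joining_cost k) R1 B1"
      proof cases
        case 1
        then obtain h where "inj_on h (fst (star k))" "\<And>e. e \<in> snd (star k) \<Longrightarrow> \<phi> ` h ` e \<in> R1"
          by (auto simp: contains_copy_def)
        then have "contains_copy R1 (star k)"
          unfolding contains_copy_def
          using \<phi> by (intro exI[of _ "\<phi> \<circ> h"]) (auto simp: image_comp inj_on_def inj_def)
        then show ?thesis by (rule forces_star)
      next
        case 2
        then obtain g where g: "inj_on g {..<m}" "\<And>i. Suc i < m \<Longrightarrow> {g i, g (Suc i)} \<in> {e. \<phi> ` e \<in> B1}"
          by (auto simp: contains_path_iff)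
        define g' where "g' = \<phi> \<circ> g"
        have g': "inj_on g' {..<m}" "\<And>i. Suc i < m \<Longrightarrow> {g' i, g' (Suc i)} \<in> B1"
          using g \<phi> by (auto simp: g'_def inj_on_def inj_def)
        have disj: "f ` {..<n} \<inter> g' ` {..<m} = {}"
          using N by (fastforce simp: g'_def \<phi>_def)
        show ?thesis
        proof (rule forces_weaken[OF forces_common_blue_neighbour])
          fix R' B' assume *: "B1 \<subseteq> B' \<and> (contains_copy R' (star k) \<or>
            (\<exists>w. w \<notin> f ` {..<n} \<union> g' ` {..<m} \<and> {f (n - 1), w} \<in> B' \<and> {g' 0, w} \<in> B'))"
          have fB: "{f i, f (Suc i)} \<in> B'" if "Suc i < n" for i using f(2)[OF that] ext * by blast
          have gB: "{g' i, g' (Suc i)} \<in> B'" if "Suc i < m" for i using g'(2)[OF that] * by blast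
          show "?Q R' B'"
            using contains_joined_path[OF f(1) fB g'(1) gB disj] * unfolding won_def by blast
        qed (use assms in auto)
      qed
    qed
  qed
qed


section \<open>The limit\<close>

lemma online_ramsey_antimono:
  assumes "finite_graph G" "finite_graph H'"
    and "\<And>F. contains_copy F H' \<Longrightarrow> contains_copy F H"
  shows "online_ramsey G H \<le> online_ramsey G H'"
  using forces_online_ramsey[OF assms(1,2)] assms(3)
  by (intro online_ramsey_le) (auto simp: won_def elim!: forces_weaken)

text \<open>The connecting vertex makes the path one vertex longer than \<open>n + m\<close>; the surplus is dropped.\<close>

lemma online_ramsey_star_path_subadditive:
  assumes "k \<ge> 1"
  shows "online_ramsey (star k) (path (n + m))
    \<le> online_ramsey (star k) (path n) + online_ramsey (star k) (path m) + joining_cost k"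
proof (cases "n = 0 \<or> m = 0")
  case False
  have "online_ramsey (star k) (path (n + m)) \<le> online_ramsey (star k) (path (n + m + 1))"
    using finite_graph_star finite_graph_path contains_shorter_path
    by (intro online_ramsey_antimono) auto
  also have "\<dots> \<le> online_ramsey (star k) (path n) +
      (online_ramsey (star k) (path m) + joining_cost k)"
    using False assms
    by (intro online_ramsey_le forces_longer_path forces_online_ramsey
        finite_graph_star finite_graph_path) auto
  finally show ?thesis by simp
qed auto

lemma online_ramsey_star_cycle_bounds:
  assumes "k \<ge> 1" "n \<ge> 3"
  shows "online_ramsey (star k) (path n) \<le> online_ramsey (star k) (cycle n)"
    and "online_ramsey (star k) (cycle n) \<le> online_ramsey (star k) (path n) + joining_cost k"
proof -
  show "online_ramsey (star k) (path n) \<le> online_ramsey (star k) (cycle n)"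
    using finite_graph_star finite_graph_cycle[OF assms(2)] contains_path_of_cycle
    by (intro online_ramsey_antimono) auto
  have "online_ramsey (star k) (cycle (Suc (n - 1)))
      \<le> online_ramsey (star k) (path (n - 1)) + joining_cost k"
    using assms
    by (intro online_ramsey_le forces_cycle forces_online_ramsey
        finite_graph_star finite_graph_path) auto
  also have "online_ramsey (star k) (path (n - 1)) \<le> online_ramsey (star k) (path n)"
    using finite_graph_star finite_graph_path contains_shorter_path
    by (intro online_ramsey_antimono) auto
  finally show "online_ramsey (star k) (cycle n) \<le> online_ramsey (star k) (path n) + joining_cost k"
    using assms(2) by simp
qed

theorem theorem1p5:
  fixes k :: nat
  assumes "k \<ge> 1"
  shows "\<exists>L :: real. (\<lambda>n. real (online_ramsey (star k) (cycle n)) / real n) \<longlonglongrightarrow> L"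
proof -
  \<comment> \<open>Adding the cost once to every term turns near-subadditivity into subadditivity.\<close>
  define a where "a n = real (online_ramsey (star k) (path n) + joining_cost k)" for n
  define c where "c n = real (online_ramsey (star k) (cycle n))" for n
  let ?C = "real (joining_cost k)"
  have "a (m + n) \<le> a m + a n" for m n
    using online_ramsey_star_path_subadditive[OF assms, of m n] by (simp add: a_def)
  then obtain L where L: "(\<lambda>n. a n / real n) \<longlonglongrightarrow> L"
    using fekete_nonneg[of a] by (auto simp: a_def)
  have "(\<lambda>n. a n / real n - ?C / real n) \<longlonglongrightarrow> L - 0"
    by (intro tendsto_diff L lim_const_over_n)
  then have lower: "(\<lambda>n. a n / real n - ?C / real n) \<longlonglongrightarrow> L" by simp
  have bounds: "a n - ?C \<le> c n" "c n \<le> a n" if "n \<ge> 3" for n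
    using online_ramsey_star_cycle_bounds[OF assms that] by (simp_all add: a_def c_def)
  have "(\<lambda>n. c n / real n) \<longlonglongrightarrow> L"
  proof (rule tendsto_sandwich[OF _ _ lower L])
    show "\<forall>\<^sub>F n in sequentially. a n / real n - ?C / real n \<le> c n / real n"
      using bounds(1) unfolding diff_divide_distrib[symmetric]
      by (intro eventually_sequentiallyI[of 3] divide_right_mono) auto
    show "\<forall>\<^sub>F n in sequentially. c n / real n \<le> a n / real n"
      using bounds(2) by (intro eventually_sequentiallyI[of 3] divide_right_mono) auto
  qed
  then show ?thesis unfolding c_def by blast
qed

end
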